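(* Let $K$ be a field, let $n\ge 1$, and let $S=K[x_1,\ldots,x_n]$ with its standard $\mathbb Z^n$-grading. Let $M$ be a nonzero finitely generated $\mathbb Z^n$-graded $S$-module. If $M$ is torsion free, then $\operatorname{sdepth}(M)\ge 1$.
   Context: The standard $\mathbb Z^n$-grading on $S$ is the one in which $x_i$ has degree the $i$-th standard basis vector of $\mathbb Z^n$. A Stanley decomposition of a nonzero finitely generated $\mathbb Z^n$-graded $S$-module $M$ is a finite direct sum decomposition $\mathcal D:\ M=\bigoplus_{i=1}^r m_iK[Z_i]$ as a $K$-vector space, where each $m_i\in M$ is homogeneous, $Z_i\subset\{x_1,\ldots,x_n\}$ is a subset (possibly empty), $m_iK[Z_i]$ is the $K[Z_i]$-submodule of $M$ generated by $m_i$, and $m_iK[Z_i]$ is a free $K[Z_i]$-module of rank one (i.e. $m_i$ is not annihilated by any nonzero element of $K[Z_i]$). Put $\operatorname{sdepth}(\mathcal D)=\min_{1\le i\le r}|Z_i|$. The Stanley depth of $M$ is $\operatorname{sdepth}(M)=\max\{\operatorname{sdepth}(\mathcal D)\}$, the maximum over all Stanley decompositions $\mathcal D$ of $M$. *)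

theory Defs
  imports Complex_Main "HOL-Library.Poly_Mapping"
begin

text \<open>
  The polynomial ring \<open>S = K[x\<^sub>1, \<dots>, x\<^sub>n]\<close> is the monoid algebra of the monomials
  \<open>'n \<Rightarrow>\<^sub>0 nat\<close> over \<open>'k\<close>. The variables are indexed by the finite type \<open>'n\<close>, so \<open>n = CARD('n) \<ge> 1\<close>,
  and degrees in \<open>\<int>\<^sup>n\<close> are functions \<open>'n \<Rightarrow> int\<close>. An \<open>S\<close>-module is a type \<open>'m\<close> with a scalar
  multiplication satisfying the library locale \<^locale>\<open>module\<close>.
\<close>

type_synonym ('n, 'k) polynomial = "('n \<Rightarrow>\<^sub>0 nat) \<Rightarrow>\<^sub>0 'k"

text \<open>The component of degree \<open>a\<close> of \<open>S\<close>; it is zero if \<open>a\<close> has a negative entry.\<close>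

definition poly_component ::
    "('n::finite \<Rightarrow> int) \<Rightarrow> ('n, 'k::field) polynomial set" where
  "poly_component a =
     {f. \<forall>u\<in>Poly_Mapping.keys f. \<forall>i. int (Poly_Mapping.lookup u i) = a i}"

text \<open>The polynomials involving only variables from \<open>Z\<close>, i.e. the subalgebra \<open>K[Z]\<close>.\<close>

definition poly_subring :: "'n::finite set \<Rightarrow> ('n, 'k::field) polynomial set" where
  "poly_subring Z = {f. \<forall>u\<in>Poly_Mapping.keys f. Poly_Mapping.keys u \<subseteq> Z}"

definition additive_subgroup :: "'m::ab_group_add set \<Rightarrow> bool" where
  "additive_subgroup A \<longleftrightarrow>
     0 \<in> A \<and> (\<forall>v\<in>A. \<forall>w\<in>A. v + w \<in> A) \<and> (\<forall>v\<in>A. - v \<in> A)"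

text \<open>
  The whole group \<open>'m\<close> is the internal direct sum of the subgroups \<open>A i\<close>, \<open>i \<in> I\<close>. Families indexed
  by \<open>I\<close> are extended by zero outside \<open>I\<close>, so that uniqueness is meaningful for functions on the
  whole index type.
\<close>

definition is_direct_sum :: "'i set \<Rightarrow> ('i \<Rightarrow> 'm::ab_group_add set) \<Rightarrow> bool" where
  "is_direct_sum I A \<longleftrightarrow>
     (\<forall>i\<in>I. additive_subgroup (A i)) \<and>
     (\<forall>v. \<exists>!c. (\<forall>i\<in>I. c i \<in> A i) \<and> (\<forall>i. i \<notin> I \<longrightarrow> c i = 0) \<and>
               finite {i. c i \<noteq> 0} \<and> v = (\<Sum>i | c i \<noteq> 0. c i))"

definition graded_module ::
    "(('n::finite, 'k::field) polynomial \<Rightarrow> 'm::ab_group_add \<Rightarrow> 'm) \<Rightarrow>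
     (('n \<Rightarrow> int) \<Rightarrow> 'm set) \<Rightarrow> bool" where
  "graded_module scale G \<longleftrightarrow>
     module scale \<and> is_direct_sum UNIV G \<and>
     (\<forall>a b. \<forall>f\<in>poly_component a. \<forall>v\<in>G b. scale f v \<in> G (\<lambda>i. a i + b i))"

definition finitely_generated ::
    "(('n::finite, 'k::field) polynomial \<Rightarrow> 'm::ab_group_add \<Rightarrow> 'm) \<Rightarrow> bool" where
  "finitely_generated scale \<longleftrightarrow> (\<exists>B. finite B \<and> module.span scale B = UNIV)"

definition torsion_free ::
    "(('n::finite, 'k::field) polynomial \<Rightarrow> 'm::ab_group_add \<Rightarrow> 'm) \<Rightarrow> bool" where
  "torsion_free scale \<longleftrightarrow> (\<forall>f v. scale f v = 0 \<longrightarrow> f = 0 \<or> v = 0)"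

text \<open>\<open>stanley_space scale m Z\<close> is \<open>m K[Z]\<close>.\<close>

definition stanley_space ::
    "(('n::finite, 'k::field) polynomial \<Rightarrow> 'm::ab_group_add \<Rightarrow> 'm) \<Rightarrow> 'm \<Rightarrow> 'n set \<Rightarrow> 'm set" where
  "stanley_space scale m Z = (\<lambda>f. scale f m) ` poly_subring Z"

text \<open>
  A decomposition is the list of the pairs \<open>(m\<^sub>i, Z\<^sub>i)\<close>. The summands \<open>m\<^sub>i K[Z\<^sub>i]\<close> are closed under
  multiplication by constants, so a direct sum of them as subgroups is one of \<open>K\<close>-vector spaces.
\<close>

definition stanley_decomposition ::
    "(('n::finite, 'k::field) polynomial \<Rightarrow> 'm::ab_group_add \<Rightarrow> 'm) \<Rightarrow>
     (('n \<Rightarrow> int) \<Rightarrow> 'm set) \<Rightarrow> ('m \<times> 'n set) list \<Rightarrow> bool" where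
  "stanley_decomposition scale G D \<longleftrightarrow>
     (\<forall>(m, Z)\<in>set D. (\<exists>a. m \<in> G a) \<and> (\<forall>f\<in>poly_subring Z. scale f m = 0 \<longrightarrow> f = 0)) \<and>
     is_direct_sum {..<length D} (\<lambda>i. stanley_space scale (fst (D ! i)) (snd (D ! i)))"

definition sdepth_decomp :: "('m \<times> 'n::finite set) list \<Rightarrow> nat" where
  "sdepth_decomp D = Min ((\<lambda>(m, Z). card Z) ` set D)"

text \<open>
  For a nonzero module no decomposition is the empty list, and all values are at most \<open>CARD('n)\<close>.
\<close>

definition sdepth ::
    "(('n::finite, 'k::field) polynomial \<Rightarrow> 'm::ab_group_add \<Rightarrow> 'm) \<Rightarrow>
     (('n \<Rightarrow> int) \<Rightarrow> 'm set) \<Rightarrow> nat" where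
  "sdepth scale G = Max {sdepth_decomp D | D. stanley_decomposition scale G D}"

end

theory Submission
  imports Defs
begin

text \<open>
  Let \<open>l\<close> and \<open>h\<close> bound the degrees of finitely many homogeneous generators from below and above. Then
  \<open>M\<^sub>a = 0\<close> unless \<open>l \<le> a\<close>, and multiplication by \<open>x\<^sub>i\<close> maps \<open>M\<^sub>a\<close> onto the next component
  as soon as \<open>h\<^sub>i \<le> a\<^sub>i\<close>. Fix a variable \<open>x\<^sub>p\<close>, and call \<open>a\<close> outer if \<open>h\<^sub>i \<le> a\<^sub>i\<close> for some
  \<open>i \<noteq> p\<close>. The degrees \<open>a \<ge> l\<close> that are not outer form finitely many lines in direction \<open>p\<close>, and on each
  line \<open>M\<close> is a finitely generated torsion free, hence free, graded module over \<open>K[x\<^sub>p]\<close>. The outer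
  part is the direct sum of the \<open>M\<^sub>c \<otimes> K[x\<^sub>i | c\<^sub>i = h\<^sub>i]\<close> over the outer degrees \<open>c\<close> with
  \<open>l \<le> c \<le> h\<close>, and each of these polynomial rings has at least one variable. Both parts are treated
  at once: a basis of \<open>M\<^sub>a\<close> arises by shifting a basis of a smaller degree (the parent of \<open>a\<close>) and
  completing it with new generators.
\<close>

section \<open>Linear algebra: completing a subspace of a finite-dimensional space\<close>

definition (in vector_space) complement_basis :: "'b set \<Rightarrow> 'b set \<Rightarrow> 'b set \<Rightarrow> bool" where
  "complement_basis V W C \<longleftrightarrow> finite C \<and> C \<subseteq> V \<and>
    (\<forall>v\<in>V. \<exists>w\<in>W. \<exists>k. v = w + (\<Sum>c\<in>C. k c *s c)) \<and>
    (\<forall>w\<in>W. \<forall>k. w + (\<Sum>c\<in>C. k c *s c) = 0 \<longrightarrow> w = 0 \<and> (\<forall>c\<in>C. k c = 0))"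

text \<open>A basis \<open>B\<close> of \<open>W\<close> extends to a basis \<open>B'\<close> of
  \<open>V\<close>, and \<open>C = B' - B\<close> works. Both are finite because \<open>V\<close>
  lies in the span of the finite set \<open>F\<close>.\<close>

lemma (in vector_space) ex_complement_basis:
  assumes "finite F" "V \<subseteq> span F" "subspace V" "subspace W" "W \<subseteq> V"
  shows "\<exists>C. complement_basis V W C"
proof -
  obtain B where B: "B \<subseteq> W" "independent B" "W \<subseteq> span B"
    using maximal_independent_subset by blast
  obtain B' where B': "B \<subseteq> B'" "B' \<subseteq> V" "independent B'" "V \<subseteq> span B'"
    using maximal_independent_subset_extend[of B V] B assms(5) by blast
  have fB': "finite B'"
    using independent_span_bound[OF assms(1) B'(3)] B'(2) assms(2) by blast
  then have fB: "finite B" using B'(1) finite_subset by blast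
  have split: "(\<Sum>b\<in>B'. k b *s b) = (\<Sum>b\<in>B. k b *s b) + (\<Sum>b\<in>B' - B. k b *s b)" for k
    using sum.subset_diff[OF B'(1) fB'] by (simp add: add.commute)
  have "\<exists>w\<in>W. \<exists>k. v = w + (\<Sum>c\<in>B' - B. k c *s c)" if v: "v \<in> V" for v
  proof -
    obtain k where k: "v = (\<Sum>b\<in>B'. k b *s b)"
      using v B'(4) unfolding span_finite[OF fB'] by auto
    have "(\<Sum>b\<in>B. k b *s b) \<in> W"
      using B(1) assms(4) by (intro subspace_sum subspace_scale) auto
    with k split[of k] show ?thesis by auto
  qed
  moreover have "w = 0 \<and> (\<forall>c\<in>B' - B. k c = 0)"
    if w: "w \<in> W" and z: "w + (\<Sum>c\<in>B' - B. k c *s c) = 0" for w k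
  proof -
    obtain h where h: "w = (\<Sum>b\<in>B. h b *s b)"
      using w B(3) unfolding span_finite[OF fB] by auto
    \<comment> \<open>Once \<open>w\<close> is expanded in \<open>B\<close>, the relation between
      \<open>w\<close> and the new vectors is a relation within the independent set
      \<open>B'\<close>.\<close>
    define k' where "k' b = (if b \<in> B then h b else k b)" for b
    have "(\<Sum>b\<in>B'. k' b *s b) = 0"
      using z unfolding split h by (simp add: k'_def)
    then have k': "k' b = 0" if "b \<in> B'" for b
      using independentD[OF B'(3) fB' subset_refl _ that, of k'] by simp
    have "h b = 0" if "b \<in> B" for b
      using k'[of b] that B'(1) by (auto simp: k'_def)
    moreover have "k c = 0" if "c \<in> B' - B" for c
      using k'[of c] that by (auto simp: k'_def)
    ultimately show ?thesis by (simp add: h)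
  qed
  ultimately show ?thesis
    unfolding complement_basis_def using fB' B'(2) by (intro exI[of _ "B' - B"]) auto
qed

section \<open>Monomials, exponents and degree shifts\<close>

lemma poly_mapping_eq_sum_single:
  "f = (\<Sum>u\<in>Poly_Mapping.keys f. Poly_Mapping.single u (Poly_Mapping.lookup f u))"
  by (rule poly_mapping_eqI)
    (auto simp: lookup_sum lookup_single when_def in_keys_iff)

definition shift :: "('n \<Rightarrow> int) \<Rightarrow> ('n \<Rightarrow>\<^sub>0 nat) \<Rightarrow> 'n \<Rightarrow> int" where
  "shift a u = (\<lambda>i. a i + int (Poly_Mapping.lookup u i))"

text \<open>The exponent of \<open>x\<^bsup>a - d\<^esup>\<close>; junk unless \<open>d \<le> a\<close>.\<close>

definition gap :: "('n::finite \<Rightarrow> int) \<Rightarrow> ('n \<Rightarrow> int) \<Rightarrow> ('n \<Rightarrow>\<^sub>0 nat)" where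
  "gap d a = Abs_poly_mapping (\<lambda>i. nat (a i - d i))"

lemma lookup_gap [simp]: "Poly_Mapping.lookup (gap d a) i = nat (a i - d i)"
  by (simp add: gap_def Abs_poly_mapping_inverse)

lemma shift_gap: "d \<le> a \<Longrightarrow> shift d (gap d a) = a"
  by (auto simp: shift_def le_fun_def)

lemma gap_shift [simp]: "gap d (shift d u) = u"
  by (rule poly_mapping_eqI) (simp add: shift_def)

lemma le_shift [simp]: "d \<le> shift d u"
  by (auto simp: shift_def le_fun_def)

lemma gap_refl [simp]: "gap a a = 0"
  by (rule poly_mapping_eqI) simp

lemma gap_add: "d \<le> b \<Longrightarrow> b \<le> a \<Longrightarrow> gap b a + gap d b = gap d a"
  by (rule poly_mapping_eqI) (auto simp: lookup_add le_fun_def nat_add_distrib[symmetric])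

section \<open>Homogeneous components\<close>

locale graded_polynomial_module =
  fixes scale :: "('n::finite, 'k::field) polynomial \<Rightarrow> 'm::ab_group_add \<Rightarrow> 'm"
    and G :: "('n \<Rightarrow> int) \<Rightarrow> 'm set"
  assumes graded: "graded_module scale G"
begin

sublocale module scale
  using graded by (simp add: graded_module_def)

abbreviation kscale :: "'k \<Rightarrow> 'm \<Rightarrow> 'm" where
  "kscale c \<equiv> scale (Poly_Mapping.single 0 c)"

abbreviation mon :: "('n \<Rightarrow>\<^sub>0 nat) \<Rightarrow> 'm \<Rightarrow> 'm" where
  "mon u \<equiv> scale (Poly_Mapping.single u 1)"

text \<open>Restriction of scalars to the constants. The components of \<open>G\<close> are only
  subspaces over the field, not submodules over S, so bases are taken in this structure.\<close>

sublocale K: vector_space kscale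
  by standard (simp_all add: scale_right_distrib single_add scale_left_distrib mult_single)

lemma mon_mon: "mon u (mon w v) = mon (u + w) v"
  by (simp add: mult_single)

lemma mon_sum: "mon u (\<Sum>x\<in>A. kscale (k x) (h x)) = (\<Sum>x\<in>A. kscale (k x) (mon u (h x)))"
  by (simp add: scale_sum_right mult.commute)

lemma scale_eq_sum:
  "scale f v = (\<Sum>u\<in>Poly_Mapping.keys f. kscale (Poly_Mapping.lookup f u) (mon u v))"
  by (subst poly_mapping_eq_sum_single[of f]) (simp add: scale_sum_left mult_single)

lemma direct_sum: "is_direct_sum UNIV G"
  using graded by (simp add: graded_module_def)

lemma scale_in_G:
  "f \<in> poly_component a \<Longrightarrow> v \<in> G b \<Longrightarrow> scale f v \<in> G (\<lambda>i. a i + b i)"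
  using graded by (simp add: graded_module_def)

lemma mon_in_G:
  assumes "v \<in> G a"
  shows "mon u v \<in> G (shift a u)"
proof -
  have "Poly_Mapping.single u 1 \<in> poly_component (\<lambda>i. int (Poly_Mapping.lookup u i))"
    by (simp add: poly_component_def)
  from scale_in_G[OF this assms] show ?thesis by (simp add: shift_def add.commute)
qed

lemma subspace_G: "K.subspace (G a)"
proof (rule K.subspaceI)
  have *: "additive_subgroup (G a)"
    using direct_sum by (simp add: is_direct_sum_def)
  then show "0 \<in> G a" "\<And>x y. x \<in> G a \<Longrightarrow> y \<in> G a \<Longrightarrow> x + y \<in> G a"
    by (auto simp: additive_subgroup_def)
  fix c :: 'k and x assume x: "x \<in> G a"
  have "Poly_Mapping.single 0 c \<in> poly_component (\<lambda>i::'n. 0)"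
    by (simp add: poly_component_def)
  from scale_in_G[OF this x] show "kscale c x \<in> G a" by simp
qed

definition is_comp :: "'m \<Rightarrow> (('n \<Rightarrow> int) \<Rightarrow> 'm) \<Rightarrow> bool" where
  "is_comp v c \<longleftrightarrow> (\<forall>a. c a \<in> G a) \<and> finite {a. c a \<noteq> 0} \<and> v = (\<Sum>a | c a \<noteq> 0. c a)"

definition comp :: "'m \<Rightarrow> ('n \<Rightarrow> int) \<Rightarrow> 'm" where
  "comp v = (THE c. is_comp v c)"

lemma ex1_is_comp: "\<exists>!c. is_comp v c"
  using direct_sum by (simp add: is_direct_sum_def is_comp_def)

lemma is_comp_comp: "is_comp v (comp v)"
  unfolding comp_def by (rule theI'[OF ex1_is_comp])

lemma comp_eqI: "is_comp v c \<Longrightarrow> comp v = c"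
  using ex1_is_comp is_comp_comp by blast

text \<open>Any finite set containing the support will do, such as the union of two supports for a
  sum, where cancellation may shrink the true support.\<close>

lemma is_compI:
  assumes "\<And>a. c a \<in> G a" "finite A" "\<And>a. a \<notin> A \<Longrightarrow> c a = 0" "v = (\<Sum>a\<in>A. c a)"
  shows "is_comp v c"
proof -
  have "{a. c a \<noteq> 0} \<subseteq> A" using assms(3) by blast
  then show ?thesis
    using assms unfolding is_comp_def
    by (auto intro: finite_subset intro!: sum.mono_neutral_right)
qed

lemma comp_in_G: "comp v a \<in> G a"
  and finite_comp: "finite {a. comp v a \<noteq> 0}"
  and sum_comp: "v = (\<Sum>a | comp v a \<noteq> 0. comp v a)"
  using is_comp_comp[of v] by (auto simp: is_comp_def)

lemma sum_comp':
  assumes "finite A" "{a. comp v a \<noteq> 0} \<subseteq> A"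
  shows "v = (\<Sum>a\<in>A. comp v a)"
  using sum_comp[of v] sum.mono_neutral_left[OF assms, of "comp v"] by auto

lemma comp_add: "comp (v + w) a = comp v a + comp w a"
proof -
  let ?A = "{a. comp v a \<noteq> 0} \<union> {a. comp w a \<noteq> 0}"
  have "is_comp (v + w) (\<lambda>a. comp v a + comp w a)"
  proof (rule is_compI[of _ ?A])
    show "v + w = (\<Sum>a\<in>?A. comp v a + comp w a)"
      using sum_comp'[of ?A v] sum_comp'[of ?A w] finite_comp by (simp add: sum.distrib)
  qed (auto intro: K.subspace_add[OF subspace_G] comp_in_G finite_comp)
  from comp_eqI[OF this] show ?thesis by simp
qed

lemma comp_kscale: "comp (kscale k v) a = kscale k (comp v a)"
proof -
  have "is_comp (kscale k v) (\<lambda>a. kscale k (comp v a))"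
  proof (rule is_compI[of _ "{a. comp v a \<noteq> 0}"])
    show "kscale k v = (\<Sum>a | comp v a \<noteq> 0. kscale k (comp v a))"
      by (subst sum_comp[of v]) (simp add: scale_sum_right)
  qed (auto intro: K.subspace_scale[OF subspace_G] comp_in_G finite_comp)
  from comp_eqI[OF this] show ?thesis by simp
qed

lemma comp_homogeneous:
  assumes "v \<in> G a"
  shows "comp v b = (if b = a then v else 0)"
proof -
  have "is_comp v (\<lambda>b. if b = a then v else 0)"
    by (rule is_compI[of _ "{a}"]) (auto simp: assms K.subspace_0[OF subspace_G])
  from comp_eqI[OF this] show ?thesis by simp
qed

lemma comp_0 [simp]: "comp 0 a = 0"
  using comp_homogeneous[OF K.subspace_0[OF subspace_G]] by simp

lemma comp_sum: "comp (\<Sum>x\<in>A. h x) a = (\<Sum>x\<in>A. comp (h x) a)"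
  by (induction A rule: infinite_finite_induct) (auto simp: comp_add)

text \<open>Distinct monomials move \<open>m\<close> to distinct degrees, so at most one term of
  \<open>f\<close> lands in degree \<open>a\<close>. The test \<open>d \<le> a\<close> is there
  because \<open>gap\<close> truncates.\<close>

lemma comp_scale:
  assumes "m \<in> G d"
  shows "comp (scale f m) a =
    (if d \<le> a then kscale (Poly_Mapping.lookup f (gap d a)) (mon (gap d a) m) else 0)"
proof -
  have "comp (scale f m) a =
    (\<Sum>u\<in>Poly_Mapping.keys f. kscale (Poly_Mapping.lookup f u) (if a = shift d u then mon u m else 0))"
    unfolding scale_eq_sum[of f m] comp_sum comp_kscale
    by (simp only: comp_homogeneous[OF mon_in_G[OF assms]])
  also have "\<dots> = (\<Sum>u\<in>Poly_Mapping.keys f.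
     if u = gap d a \<and> d \<le> a then kscale (Poly_Mapping.lookup f u) (mon u m) else 0)"
    by (rule sum.cong) (auto simp: shift_gap)
  also have "\<dots> = (if d \<le> a then kscale (Poly_Mapping.lookup f (gap d a)) (mon (gap d a) m) else 0)"
    by (auto simp: in_keys_iff)
  finally show ?thesis .
qed

text \<open>The homogeneous components of a finite generating set generate as well. A generator of
  degree \<open>d\<close> meets degree \<open>a\<close> only in its multiple by x^(a - d), so these
  multiples span \<open>G a\<close> over the field.\<close>

lemma finitely_generated_span:
  assumes "finitely_generated scale"
  shows "\<exists>H. finite H \<and> (\<forall>(d, b)\<in>H. b \<in> G d) \<and>
    (\<forall>a. G a \<subseteq> K.span ((\<lambda>(d, b). mon (gap d a) b) ` {t\<in>H. fst t \<le> a}))"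
proof -
  obtain B where B: "finite B" "span B = UNIV"
    using assms by (auto simp: finitely_generated_def)
  \<comment> \<open>Dropping the zero components makes \<open>H\<close> finite.\<close>
  define H where "H = (\<Union>b\<in>B. (\<lambda>d. (d, comp b d)) ` {d. comp b d \<noteq> 0})"
  define E where "E a = (\<lambda>(d, b). mon (gap d a) b) ` {t\<in>H. fst t \<le> a}" for a
  have H_hom: "\<And>d b. (d, b) \<in> H \<Longrightarrow> b \<in> G d"
    by (auto simp: H_def comp_in_G)
  have E_hom: "E a \<subseteq> G a" for a
  proof
    fix x assume "x \<in> E a"
    then obtain d b where "(d, b) \<in> H" "d \<le> a" "x = mon (gap d a) b"
      by (auto simp: E_def)
    then show "x \<in> G a" using mon_in_G[OF H_hom] shift_gap by metis
  qed
  have E_mon: "mon u x \<in> E (shift a u)" if "x \<in> E a" for a u x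
  proof -
    from that obtain d b where db: "(d, b) \<in> H" "d \<le> a" "x = mon (gap d a) b"
      by (auto simp: E_def)
    have "mon u x = mon (gap d (shift a u)) b"
      using gap_add[OF db(2) le_shift[of a u]] by (simp only: db(3) mon_mon gap_shift)
    moreover have "d \<le> shift a u" using db(2) le_shift order_trans by blast
    ultimately show ?thesis
      unfolding E_def using db(1) by (intro image_eqI[of _ _ "(d, b)"]) simp_all
  qed
  \<comment> \<open>The span of all monomial multiples is an S-submodule containing
    \<open>B\<close>, hence the whole module.\<close>
  let ?R = "K.span (\<Union>a. E a)"
  have mon_R: "mon u x \<in> ?R" if "x \<in> ?R" for u x
    using that
  proof (induction rule: K.span_induct)
    case base
    show ?case
    proof (rule K.subspaceI)
      fix c x assume "x \<in> {x. mon u x \<in> ?R}"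
      then have "kscale c (mon u x) \<in> ?R" by (blast intro: K.span_scale)
      then show "kscale c x \<in> {x. mon u x \<in> ?R}" by (simp add: mult.commute)
    qed (simp_all add: K.span_zero scale_right_distrib K.span_add)
  next
    case (step x)
    then show ?case using E_mon by (blast intro: K.span_base)
  qed
  have "subspace ?R"
  proof (rule subspaceI)
    fix f x assume "x \<in> ?R"
    then show "scale f x \<in> ?R"
      unfolding scale_eq_sum[of f x] by (intro K.span_sum K.span_scale mon_R)
  qed (auto intro: K.span_zero K.span_add)
  moreover have "B \<subseteq> ?R"
  proof
    fix b assume b: "b \<in> B"
    have "comp b d \<in> ?R" if "comp b d \<noteq> 0" for d
    proof -
      have "(d, comp b d) \<in> H" using b that by (auto simp: H_def)
      then have "comp b d \<in> E d"
        unfolding E_def by (intro image_eqI[of _ _ "(d, comp b d)"]) simp_all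
      then show ?thesis by (blast intro: K.span_base)
    qed
    then show "b \<in> ?R"
      by (subst sum_comp[of b]) (auto intro: K.span_sum)
  qed
  ultimately have R: "?R = UNIV"
    using span_minimal[of B ?R] B(2) by auto
  \<comment> \<open>Projection to degree \<open>a\<close> is linear, fixes \<open>E a\<close> and
    kills every other \<open>E b\<close>.\<close>
  have comp_E: "comp v a \<in> K.span (E a)" for v a
  proof -
    have "v \<in> ?R" by (simp add: R)
    then show ?thesis
    proof (induction rule: K.span_induct)
      case base
      show ?case
        by (rule K.subspaceI)
          (simp_all add: comp_add comp_kscale K.span_zero K.span_add K.span_scale
            del: scale_scale)
    next
      case (step x)
      then obtain b where "x \<in> E b" by blast
      with E_hom have "comp x a = (if a = b then x else 0)"
        by (intro comp_homogeneous) blast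
      with \<open>x \<in> E b\<close> show ?case by (simp add: K.span_zero K.span_base)
    qed
  qed
  have "G a \<subseteq> K.span (E a)" for a
  proof
    fix v assume "v \<in> G a"
    then show "v \<in> K.span (E a)" using comp_E[of v a] by (simp add: comp_homogeneous)
  qed
  moreover have "finite H"
    using B(1) finite_comp by (auto simp: H_def)
  ultimately show ?thesis using H_hom unfolding E_def by (intro exI[of _ H]) blast
qed

text \<open>The bounds are those of the generator degrees. For the last property, a generator of
  degree \<open>d \<le> a\<close> has \<open>d \<le> b\<close>: where \<open>b i < a i\<close> one
  has \<open>d i \<le> h i \<le> b i\<close>, and elsewhere \<open>b i = a i\<close>. So its
  multiple in degree \<open>a\<close> passes through degree \<open>b\<close>.\<close>

lemma finitely_generated_bounds:
  assumes "finitely_generated scale"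
  obtains l h where
    "\<And>a. \<exists>F. finite F \<and> G a \<subseteq> K.span F"
    "\<And>a v. v \<in> G a \<Longrightarrow> v \<noteq> 0 \<Longrightarrow> l \<le> a"
    "\<And>b a. b \<le> a \<Longrightarrow> (\<And>i. b i < a i \<Longrightarrow> h i \<le> b i) \<Longrightarrow> G a \<subseteq> mon (gap b a) ` G b"
proof -
  obtain H where H: "finite H" "\<And>d b. (d, b) \<in> H \<Longrightarrow> b \<in> G d"
    "\<And>a. G a \<subseteq> K.span ((\<lambda>(d, b). mon (gap d a) b) ` {t\<in>H. fst t \<le> a})"
    using finitely_generated_span[OF assms] by (auto simp del: split_paired_All)
  \<comment> \<open>The inserted \<open>0\<close> keeps \<open>Min\<close> and \<open>Max\<close>
    meaningful when \<open>H\<close> is empty; it can only weaken the bounds.\<close>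
  define l where "l i = Min (insert 0 ((\<lambda>t. fst t i) ` H))" for i
  define h where "h i = Max (insert 0 ((\<lambda>t. fst t i) ` H))" for i
  have lh: "l i \<le> fst t i" "fst t i \<le> h i" if "t \<in> H" for t i
    using H(1) that by (auto simp: l_def h_def)
  show ?thesis
  proof (rule that[of l h])
    show "\<exists>F. finite F \<and> G a \<subseteq> K.span F" for a
      using H(1) H(3)[of a]
      by (intro exI[of _ "(\<lambda>(d, b). mon (gap d a) b) ` {t\<in>H. fst t \<le> a}"]) simp
    show "l \<le> a" if "v \<in> G a" "v \<noteq> 0" for v a
    proof -
      have "{t\<in>H. fst t \<le> a} \<noteq> {}"
      proof
        assume "{t\<in>H. fst t \<le> a} = {}"
        then have "G a \<subseteq> {0}" using H(3)[of a] by (simp only: image_empty K.span_empty)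
        then show False using that by blast
      qed
      then obtain t where "t \<in> H" "fst t \<le> a" by blast
      then show ?thesis using lh(1)[of t] by (auto simp: le_fun_def intro: order_trans)
    qed
    show "G a \<subseteq> mon (gap b a) ` G b"
      if ba: "b \<le> a" and hb: "\<And>i. b i < a i \<Longrightarrow> h i \<le> b i" for b a
    proof -
      have hom: "module_hom kscale kscale (mon (gap b a))"
        by unfold_locales (auto simp: scale_right_distrib mult.commute)
      have "K.span ((\<lambda>(d, b). mon (gap d a) b) ` {t\<in>H. fst t \<le> a}) \<subseteq> mon (gap b a) ` G b"
      proof (rule K.span_minimal)
        show "K.subspace (mon (gap b a) ` G b)"
          using module_hom.subspace_image[OF hom subspace_G] .
        show "(\<lambda>(d, b). mon (gap d a) b) ` {t\<in>H. fst t \<le> a} \<subseteq> mon (gap b a) ` G b"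
        proof clarsimp
          fix d m assume dm: "(d, m) \<in> H" "d \<le> a"
          have "d \<le> b"
            unfolding le_fun_def
          proof
            fix i
            show "d i \<le> b i"
              using lh(2)[OF dm(1), of i] hb[of i] le_funD[OF ba, of i] le_funD[OF dm(2), of i]
              by fastforce
          qed
          then have "mon (gap d a) m = mon (gap b a) (mon (gap d b) m)"
            using gap_add[OF _ ba] by (simp only: mon_mon)
          moreover have "mon (gap d b) m \<in> G b"
            using mon_in_G[OF H(2)[OF dm(1)], of "gap d b"] shift_gap[OF \<open>d \<le> b\<close>] by simp
          ultimately show "mon (gap d a) m \<in> mon (gap b a) ` G b" by blast
        qed
      qed
      then show ?thesis using H(3)[of a] by blast
    qed
  qed
qed

end

section \<open>Stanley decompositions from bases in each degree\<close>

text \<open>Subtracting two representations reduces uniqueness to the zero vector. Families are cut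
  off outside \<open>I\<close> to meet the convention of \<open>is_direct_sum\<close>.\<close>

lemma is_direct_sum_finiteI:
  fixes A :: "'i \<Rightarrow> 'm::ab_group_add set"
  assumes "finite I" and sub: "\<And>i. i \<in> I \<Longrightarrow> additive_subgroup (A i)"
    and ex: "\<And>v. \<exists>c. (\<forall>i\<in>I. c i \<in> A i) \<and> v = (\<Sum>i\<in>I. c i)"
    and indep: "\<And>c i. (\<And>i. i \<in> I \<Longrightarrow> c i \<in> A i) \<Longrightarrow> (\<Sum>i\<in>I. c i) = 0 \<Longrightarrow> i \<in> I \<Longrightarrow> c i = 0"
  shows "is_direct_sum I A"
  unfolding is_direct_sum_def
proof (intro conjI ballI allI)
  fix v
  have sum_I: "(\<Sum>i | c i \<noteq> 0. c i) = (\<Sum>i\<in>I. c i)" if "\<forall>i. i \<notin> I \<longrightarrow> c i = 0" for c :: "'i \<Rightarrow> 'm"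
    using that assms(1) by (intro sum.mono_neutral_left) auto
  show "\<exists>!c. (\<forall>i\<in>I. c i \<in> A i) \<and> (\<forall>i. i \<notin> I \<longrightarrow> c i = 0) \<and>
      finite {i. c i \<noteq> 0} \<and> v = (\<Sum>i | c i \<noteq> 0. c i)"
  proof (rule ex_ex1I)
    obtain c where c: "\<forall>i\<in>I. c i \<in> A i" "v = (\<Sum>i\<in>I. c i)" using ex by blast
    let ?c = "\<lambda>i. if i \<in> I then c i else 0"
    have "finite {i. ?c i \<noteq> 0}"
      using assms(1) by (rule finite_subset[rotated]) auto
    with c sum_I[of ?c] show "\<exists>c. (\<forall>i\<in>I. c i \<in> A i) \<and> (\<forall>i. i \<notin> I \<longrightarrow> c i = 0) \<and>
      finite {i. c i \<noteq> 0} \<and> v = (\<Sum>i | c i \<noteq> 0. c i)"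
      by (intro exI[of _ ?c]) simp
  next
    fix c c'
    assume c: "(\<forall>i\<in>I. c i \<in> A i) \<and> (\<forall>i. i \<notin> I \<longrightarrow> c i = 0) \<and>
        finite {i. c i \<noteq> 0} \<and> v = (\<Sum>i | c i \<noteq> 0. c i)"
      and c': "(\<forall>i\<in>I. c' i \<in> A i) \<and> (\<forall>i. i \<notin> I \<longrightarrow> c' i = 0) \<and>
        finite {i. c' i \<noteq> 0} \<and> v = (\<Sum>i | c' i \<noteq> 0. c' i)"
    have "c i + - c' i = 0" if "i \<in> I" for i
    proof (rule indep[OF _ _ that])
      show "c i + - c' i \<in> A i" if "i \<in> I" for i
        using sub[OF that] c c' that unfolding additive_subgroup_def by blast
      have "(\<Sum>i\<in>I. c i) = (\<Sum>i\<in>I. c' i)" using c c' sum_I by metis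
      then show "(\<Sum>i\<in>I. c i + - c' i) = 0" by (simp add: sum_subtractf)
    qed
    then have "c i = c' i" if "i \<in> I" for i using that by simp
    then show "c = c'" using c c' by (metis ext)
  qed
qed (rule sub)

text \<open>For \<open>m\<close> of degree \<open>d\<close>, the space \<open>m K[Z]\<close> has a (unique) monomial multiple of \<open>m\<close> in degree \<open>a\<close>.\<close>

definition reaches :: "'n set \<Rightarrow> ('n \<Rightarrow> int) \<Rightarrow> ('n \<Rightarrow> int) \<Rightarrow> bool" where
  "reaches Z d a \<longleftrightarrow> d \<le> a \<and> (\<forall>i. d i < a i \<longrightarrow> i \<in> Z)"

lemma reaches_shift: "reaches Z d (shift d u) \<longleftrightarrow> Poly_Mapping.keys u \<subseteq> Z"
  by (auto simp: reaches_def shift_def in_keys_iff le_fun_def)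

lemma keys_gap_subset: "reaches Z d a \<Longrightarrow> Poly_Mapping.keys (gap d a) \<subseteq> Z"
  using reaches_shift[of Z d "gap d a"] shift_gap[of d a] by (simp add: reaches_def)

lemma poly_subring_0: "0 \<in> poly_subring Z"
  and poly_subring_add: "f \<in> poly_subring Z \<Longrightarrow> g \<in> poly_subring Z \<Longrightarrow> f + g \<in> poly_subring Z"
  and poly_subring_uminus: "f \<in> poly_subring Z \<Longrightarrow> - f \<in> poly_subring Z"
  using keys_add[of f g] by (auto simp: poly_subring_def in_keys_iff)

context graded_polynomial_module
begin

text \<open>Since the generators are homogeneous, everything can be tested degree by degree: in
  degree \<open>a\<close> a Stanley space is spanned by one monomial multiple if
  \<open>reaches\<close> holds, and vanishes otherwise. The hypotheses say that these multiples form
  a basis of each component.\<close>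

lemma stanley_decompositionI:
  assumes hom: "\<And>i. i < length D \<Longrightarrow> fst (D ! i) \<in> G (d i)"
    and indep: "\<And>a k i. (\<Sum>i | i < length D \<and> reaches (snd (D ! i)) (d i) a.
        kscale (k i) (mon (gap (d i) a) (fst (D ! i)))) = 0 \<Longrightarrow>
        i < length D \<Longrightarrow> reaches (snd (D ! i)) (d i) a \<Longrightarrow> k i = 0"
    and span: "\<And>a v. v \<in> G a \<Longrightarrow> \<exists>k. v = (\<Sum>i | i < length D \<and> reaches (snd (D ! i)) (d i) a.
        kscale (k i) (mon (gap (d i) a) (fst (D ! i))))"
  shows "stanley_decomposition scale G D"
proof -
  let ?r = "length D" and ?m = "\<lambda>i. fst (D ! i)" and ?Z = "\<lambda>i. snd (D ! i)"
  \<comment> \<open>The coefficient of x^u in \<open>f i\<close> is isolated by taking the component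
    of the relation in degree \<open>shift (d i) u\<close>.\<close>
  have free: "f i = 0"
    if f: "\<And>i. i < ?r \<Longrightarrow> f i \<in> poly_subring (?Z i)"
      and z: "(\<Sum>i<?r. scale (f i) (?m i)) = 0" and i: "i < ?r" for f i
  proof (rule poly_mapping_eqI)
    fix u
    let ?a = "shift (d i) u"
    have nz: "Poly_Mapping.lookup (f j) (gap (d j) a) = 0"
      if "j < ?r" "d j \<le> a" "\<not> reaches (?Z j) (d j) a" for j a
      using f[OF that(1)] that reaches_shift[of "?Z j" "d j" "gap (d j) a"] shift_gap[OF that(2)]
      by (auto simp: poly_subring_def in_keys_iff)
    have "0 = comp (\<Sum>i<?r. scale (f i) (?m i)) ?a"
      by (simp add: z)
    also have "\<dots> = (\<Sum>j<?r. if d j \<le> ?a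
       then kscale (Poly_Mapping.lookup (f j) (gap (d j) ?a)) (mon (gap (d j) ?a) (?m j)) else 0)"
      unfolding comp_sum by (rule sum.cong) (simp_all only: comp_scale[OF hom] lessThan_iff)
    also have "\<dots> = (\<Sum>j | j < ?r \<and> reaches (?Z j) (d j) ?a.
        kscale (Poly_Mapping.lookup (f j) (gap (d j) ?a)) (mon (gap (d j) ?a) (?m j)))"
      using nz by (intro sum.mono_neutral_cong_right) (auto simp: reaches_def simp del: scale_scale)
    finally have "Poly_Mapping.lookup (f i) (gap (d i) ?a) = 0"
      using indep[of "\<lambda>j. Poly_Mapping.lookup (f j) (gap (d j) ?a)" ?a i, OF _ i]
        nz[OF i le_shift] by (cases "reaches (?Z i) (d i) ?a") (simp_all del: scale_scale)
    then show "Poly_Mapping.lookup (f i) u = Poly_Mapping.lookup 0 u" by simp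
  qed
  \<comment> \<open>\<open>U\<close> is the sum of the spaces. It is closed under addition and
    contains all homogeneous elements, hence everything.\<close>
  define U where "U = {v. \<exists>f. (\<forall>i<?r. f i \<in> poly_subring (?Z i)) \<and> v = (\<Sum>i<?r. scale (f i) (?m i))}"
  have G_U: "v \<in> U" if v: "v \<in> G a" for v a
  proof -
    obtain k where k: "v = (\<Sum>i | i < ?r \<and> reaches (?Z i) (d i) a.
        kscale (k i) (mon (gap (d i) a) (?m i)))"
      using span[OF v] by blast
    let ?f = "\<lambda>i. if reaches (?Z i) (d i) a then Poly_Mapping.single (gap (d i) a) (k i) else 0"
    have "v = (\<Sum>i<?r. scale (?f i) (?m i))"
      unfolding k by (rule sum.mono_neutral_cong_left) (auto simp: mult_single)
    moreover have "\<forall>i<?r. ?f i \<in> poly_subring (?Z i)"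
      using keys_gap_subset by (auto simp: poly_subring_def split: if_splits)
    ultimately show ?thesis unfolding U_def by (intro CollectI exI[of _ ?f] conjI)
  qed
  have U_0: "0 \<in> U"
    unfolding U_def by (auto intro!: exI[of _ "\<lambda>_. 0"] simp: poly_subring_0)
  have U_add: "v + w \<in> U" if v: "v \<in> U" and w: "w \<in> U" for v w
  proof -
    obtain f where f: "\<forall>i<?r. f i \<in> poly_subring (?Z i)" "v = (\<Sum>i<?r. scale (f i) (?m i))"
      using v by (auto simp: U_def)
    obtain g where g: "\<forall>i<?r. g i \<in> poly_subring (?Z i)" "w = (\<Sum>i<?r. scale (g i) (?m i))"
      using w by (auto simp: U_def)
    show ?thesis
      unfolding U_def using f g
      by (intro CollectI exI[of _ "\<lambda>i. f i + g i"])
        (simp add: poly_subring_add scale_left_distrib sum.distrib)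
  qed
  have U: "v \<in> U" for v
  proof -
    have "(\<Sum>a\<in>A. comp v a) \<in> U" for A
      by (induction A rule: infinite_finite_induct) (auto intro: U_0 U_add G_U[OF comp_in_G])
    then show ?thesis by (subst sum_comp)
  qed
  have "is_direct_sum {..<?r} (\<lambda>i. stanley_space scale (?m i) (?Z i))"
  proof (rule is_direct_sum_finiteI)
    show "additive_subgroup (stanley_space scale (?m i) (?Z i))" for i
      unfolding additive_subgroup_def stanley_space_def
    proof (intro conjI ballI)
      show "0 \<in> (\<lambda>f. scale f (?m i)) ` poly_subring (?Z i)"
        by (rule image_eqI[of _ _ 0]) (simp_all add: poly_subring_0)
      fix v assume "v \<in> (\<lambda>f. scale f (?m i)) ` poly_subring (?Z i)"
      then obtain f where f: "v = scale f (?m i)" "f \<in> poly_subring (?Z i)" by blast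
      show "- v \<in> (\<lambda>f. scale f (?m i)) ` poly_subring (?Z i)"
        by (rule image_eqI[of _ _ "- f"]) (simp_all add: f poly_subring_uminus)
      fix w assume "w \<in> (\<lambda>f. scale f (?m i)) ` poly_subring (?Z i)"
      then obtain g where g: "w = scale g (?m i)" "g \<in> poly_subring (?Z i)" by blast
      show "v + w \<in> (\<lambda>f. scale f (?m i)) ` poly_subring (?Z i)"
        by (rule image_eqI[of _ _ "f + g"]) (simp_all add: f g poly_subring_add scale_left_distrib)
    qed
    show "\<exists>c. (\<forall>i\<in>{..<?r}. c i \<in> stanley_space scale (?m i) (?Z i)) \<and> v = (\<Sum>i<?r. c i)" for v
    proof -
      obtain f where "\<forall>i<?r. f i \<in> poly_subring (?Z i)" "v = (\<Sum>i<?r. scale (f i) (?m i))"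
        using U[of v] by (auto simp: U_def)
      then show ?thesis
        by (intro exI[of _ "\<lambda>i. scale (f i) (?m i)"]) (auto simp: stanley_space_def)
    qed
    fix c i
    assume c: "\<And>i. i \<in> {..<?r} \<Longrightarrow> c i \<in> stanley_space scale (?m i) (?Z i)"
      and z: "(\<Sum>i<?r. c i) = 0" and i: "i \<in> {..<?r}"
    have "\<forall>i. \<exists>f. i < ?r \<longrightarrow> f \<in> poly_subring (?Z i) \<and> c i = scale f (?m i)"
      using c by (auto simp: stanley_space_def)
    then obtain f where f: "\<And>i. i < ?r \<Longrightarrow> f i \<in> poly_subring (?Z i) \<and> c i = scale (f i) (?m i)"
      by metis
    then have "(\<Sum>i<?r. scale (f i) (?m i)) = 0" using z by simp
    then have "f i = 0" using free[of f i] f i by auto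
    then show "c i = 0" using f i by simp
  qed simp
  moreover have "f = 0" if mZ: "(m, Z) \<in> set D" and f: "f \<in> poly_subring Z" "scale f m = 0" for m Z f
  proof -
    obtain i where i: "i < ?r" "D ! i = (m, Z)" using mZ by (auto simp: in_set_conv_nth)
    \<comment> \<open>Freeness of one space is \<open>free\<close> for the family that is
      \<open>f\<close> at position \<open>i\<close> and zero elsewhere; the odd conditional is this
      family evaluated at \<open>i\<close>.\<close>
    have "(if i = i then f else 0) = 0"
    proof (rule free[of "\<lambda>j. if j = i then f else 0"])
      show "(\<Sum>j<?r. scale (if j = i then f else 0) (?m j)) = 0"
        using i f by (intro sum.neutral) auto
    qed (use i f in \<open>auto simp: poly_subring_0\<close>)
    then show ?thesis by simp
  qed
  moreover have "\<exists>a. m \<in> G a" if "(m, Z) \<in> set D" for m Z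
    using that hom by (metis fst_conv in_set_conv_nth)
  ultimately show ?thesis
    unfolding stanley_decomposition_def by auto
qed

end

section \<open>Outer degrees and parents\<close>

definition outer :: "'n \<Rightarrow> ('n \<Rightarrow> int) \<Rightarrow> ('n \<Rightarrow> int) \<Rightarrow> bool" where
  "outer p h a \<longleftrightarrow> (\<exists>i. i \<noteq> p \<and> h i \<le> a i)"

text \<open>The variable set attached to a generator of degree \<open>d\<close>. Generators will
  satisfy \<open>d \<le> h\<close>, so the outer case then gives the coordinates with
  \<open>d i = h i\<close>; inner generators move only along their line.\<close>

definition dirs :: "'n \<Rightarrow> ('n \<Rightarrow> int) \<Rightarrow> ('n \<Rightarrow> int) \<Rightarrow> 'n set" where
  "dirs p h d = (if outer p h d then {i. h i \<le> d i} else {p})"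

text \<open>
  In the second case any degree \<open>\<le> a\<close> outside \<open>{l..}\<close> would do: the module vanishes there, so
  the whole component of degree \<open>a\<close> is made of new generators.
\<close>

definition parent ::
    "'n \<Rightarrow> ('n \<Rightarrow> int) \<Rightarrow> ('n \<Rightarrow> int) \<Rightarrow> ('n \<Rightarrow> int) \<Rightarrow> 'n \<Rightarrow> int" where
  "parent p l h a =
    (if \<not> outer p h a then a(p := a p - 1)
     else if a \<le> h then (\<lambda>i. min (a i) (l i - 1))
     else (\<lambda>i. min (a i) (h i)))"

lemma dirs_nonempty: "dirs p h d \<noteq> {}"
  by (auto simp: dirs_def outer_def)

lemma outer_mono: "d \<le> a \<Longrightarrow> outer p h d \<Longrightarrow> outer p h a"
  unfolding outer_def le_fun_def by (meson order_trans)

lemma parent_le: "parent p l h a \<le> a"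
  by (auto simp: parent_def le_fun_def)

text \<open>Makes the descent to the parent strict. An inner degree loses one at \<open>p\<close>,
  an outer degree with \<open>a \<le> h\<close> drops below \<open>l\<close> everywhere, and any
  other outer degree is clipped in a coordinate exceeding \<open>h\<close>.\<close>

lemma parent_neq:
  assumes "l \<le> a"
  shows "parent p l h a \<noteq> a"
proof
  assume eq: "parent p l h a = a"
  consider "\<not> outer p h a" | "outer p h a" "a \<le> h" | "outer p h a" "\<not> a \<le> h" by blast
  then show False
  proof cases
    case 1
    then show False using fun_cong[OF eq, of p] by (simp add: parent_def)
  next
    case 2
    then show False using fun_cong[OF eq, of p] le_funD[OF assms, of p]
      by (simp add: parent_def min_def split: if_splits)
  next
    case 3
    then obtain i where "\<not> a i \<le> h i" by (auto simp: le_fun_def)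
    then show False using 3 fun_cong[OF eq, of i] by (simp add: parent_def)
  qed
qed

text \<open>This is the condition for multiplication from the parent degree to be onto, so that no
  new generators arise outside \<open>a \<le> h\<close>.\<close>

lemma parent_less_imp_ge:
  assumes "\<not> a \<le> h" "parent p l h a i < a i"
  shows "h i \<le> parent p l h a i"
proof (cases "outer p h a")
  case True
  then show ?thesis using assms by (auto simp: parent_def split: if_splits)
next
  case False
  then have i: "i = p" using assms(2) by (auto simp: parent_def split: if_splits)
  \<comment> \<open>All coordinates other than \<open>p\<close> are below \<open>h\<close>, so the
    excess sits at \<open>p\<close>, and the strict \<open>h p < a p\<close> absorbs the decrease by
    one.\<close>
  from assms(1) obtain j where "\<not> a j \<le> h j" by (auto simp: le_fun_def)
  moreover have "a j < h j" if "j \<noteq> p"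
    using False that by (auto simp: outer_def not_le)
  ultimately have "h p < a p" by force
  then show ?thesis using False i by (simp add: parent_def)
qed

lemma reaches_le: "reaches Z d a \<Longrightarrow> d \<le> a"
  by (simp add: reaches_def)

text \<open>The combinatorial core: passing from the parent to \<open>a\<close> adds only the
  generators of degree \<open>a\<close>. If \<open>a\<close> is inner, every
  \<open>d \<le> a\<close> is inner and moves only along \<open>p\<close>, so one step back
  suffices. If \<open>a\<close> is outer with \<open>a \<le> h\<close>, nothing reaches the parent;
  an inner \<open>d\<close> stays inner along \<open>p\<close>, and an outer \<open>d\<close> moves
  only where it already equals \<open>h\<close>, which leaves the box. Otherwise only outer
  \<open>d\<close> reach the clipped degree, and a coordinate that must be raised only beyond the
  clipping has \<open>d i = h i\<close>, so it is an allowed direction.\<close>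

lemma reaches_parent:
  assumes "l \<le> d" "d \<le> h"
  shows "reaches (dirs p h d) d a \<longleftrightarrow> d = a \<or> reaches (dirs p h d) d (parent p l h a)"
proof -
  have inner: "d j < h j" if "\<not> outer p h d" "j \<noteq> p" for j
    using that by (auto simp: outer_def not_le)
  consider "\<not> outer p h a" | "outer p h a" "a \<le> h" | "outer p h a" "\<not> a \<le> h" by blast
  then show ?thesis
  proof cases
    case 1
    have par: "parent p l h a = a(p := a p - 1)" using 1 by (simp add: parent_def)
    show ?thesis
    proof (intro iffI; (elim disjE)?)
      assume r: "reaches (dirs p h d) d a"
      then have "\<not> outer p h d" using 1 outer_mono[OF reaches_le[OF r], of p h] by blast
      then have dp: "d i = a i" if "i \<noteq> p" for i
        using r that le_funD[OF reaches_le[OF r], of i] by (force simp: reaches_def dirs_def)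
      show "d = a \<or> reaches (dirs p h d) d (parent p l h a)"
      proof (cases "d p = a p")
        case True
        then show ?thesis using dp by (metis ext)
      next
        case False
        then have "d p < a p" using le_funD[OF reaches_le[OF r], of p] by simp
        then show ?thesis using r dp by (auto simp: reaches_def par le_fun_def)
      qed
    next
      assume r: "reaches (dirs p h d) d (parent p l h a)"
      have le: "d \<le> a" using order_trans[OF reaches_le[OF r] parent_le] .
      then have Z: "dirs p h d = {p}" using 1 outer_mono[of d a p h] by (auto simp: dirs_def)
      have "i = p" if i: "d i < a i" for i
      proof (rule ccontr)
        assume "i \<noteq> p"
        with i have "d i < parent p l h a i" by (simp add: par)
        then have "i \<in> dirs p h d" using r by (simp add: reaches_def)
        with Z \<open>i \<noteq> p\<close> show False by simp
      qed
      then show "reaches (dirs p h d) d a"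
        using le Z by (simp add: reaches_def)
    qed (simp add: reaches_def)
  next
    case 2
    have "\<not> reaches (dirs p h d) d (parent p l h a)"
    proof
      assume "reaches (dirs p h d) d (parent p l h a)"
      from le_funD[OF reaches_le[OF this], of p] show False
        using 2 le_funD[OF assms(1), of p] by (simp add: parent_def)
    qed
    moreover have "d = a" if r: "reaches (dirs p h d) d a"
    proof (rule ccontr)
      assume "d \<noteq> a"
      then obtain i where i: "d i < a i"
        using reaches_le[OF r] by (metis antisym_conv2 ext le_funD)
      then have "i \<in> dirs p h d" using r by (simp add: reaches_def)
      moreover have "d i < h i" using i le_funD[OF 2(2), of i] by simp
      ultimately have inn: "\<not> outer p h d" "i = p" by (auto simp: dirs_def split: if_splits)
      obtain j where j: "j \<noteq> p" "h j \<le> a j" using 2(1) by (auto simp: outer_def)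
      have "d j < a j" using inner[OF inn(1) j(1)] j(2) by simp
      then show False using r inn j by (simp add: reaches_def dirs_def)
    qed
    ultimately show ?thesis by (auto simp: reaches_def)
  next
    case 3
    have par: "parent p l h a = (\<lambda>i. min (a i) (h i))" using 3 by (simp add: parent_def)
    have na: "d \<noteq> a" using 3 assms by blast
    have "reaches (dirs p h d) d (parent p l h a)" if "reaches (dirs p h d) d a"
      using that assms(2) by (auto simp: reaches_def par le_fun_def)
    moreover have "reaches (dirs p h d) d a" if r: "reaches (dirs p h d) d (parent p l h a)"
    proof -
      have le: "d \<le> a" using order_trans[OF reaches_le[OF r] parent_le] .
      have od: "outer p h d"
      proof (rule ccontr)
        assume n: "\<not> outer p h d"
        obtain j where j: "j \<noteq> p" "h j \<le> a j" using 3(1) by (auto simp: outer_def)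
        have "d j < parent p l h a j" using inner[OF n j(1)] j(2) by (simp add: par)
        then show False using r n j by (simp add: reaches_def dirs_def)
      qed
      have "i \<in> dirs p h d" if "d i < a i" for i
      proof (cases "d i < parent p l h a i")
        case True
        then show ?thesis using r by (simp add: reaches_def)
      next
        case False
        then show ?thesis using that od by (auto simp: par dirs_def)
      qed
      then show ?thesis using le by (simp add: reaches_def)
    qed
    ultimately show ?thesis using na by blast
  qed
qed

lemma finite_atLeastAtMost_fun: "finite {l..h :: 'n::finite \<Rightarrow> int}"
proof (rule finite_subset)
  let ?B = "\<Union>i. {l i..h i}"
  show "{l..h} \<subseteq> {f. \<forall>x. (x \<in> UNIV \<longrightarrow> f x \<in> ?B) \<and> (x \<notin> UNIV \<longrightarrow> f x = 0)}"
    using le_funD[of l] le_funD[of _ h] by fastforce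
  show "finite {f :: 'n \<Rightarrow> int. \<forall>x. (x \<in> UNIV \<longrightarrow> f x \<in> ?B) \<and> (x \<notin> UNIV \<longrightarrow> f x = 0)}"
    by (rule finite_set_of_finite_funs) auto
qed

section \<open>Monomial bases of the components and the induction on degrees\<close>

context graded_polynomial_module
begin

text \<open>Coefficients are indexed by generators, not by their multiples in degree
  \<open>a\<close>, so coinciding multiples of distinct generators count as dependent.\<close>

definition monomial_basis :: "(('n \<Rightarrow> int) \<times> 'm) set \<Rightarrow> ('n \<Rightarrow> int) \<Rightarrow> bool" where
  "monomial_basis S a \<longleftrightarrow> finite S \<and> (\<forall>t\<in>S. fst t \<le> a \<and> snd t \<in> G (fst t)) \<and>
     (\<forall>k. (\<Sum>t\<in>S. kscale (k t) (mon (gap (fst t) a) (snd t))) = 0 \<longrightarrow> (\<forall>t\<in>S. k t = 0)) \<and>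
     (\<forall>v\<in>G a. \<exists>k. v = (\<Sum>t\<in>S. kscale (k t) (mon (gap (fst t) a) (snd t))))"

lemma monomial_basis_indep:
  assumes "monomial_basis S a"
    and "(\<Sum>t\<in>S. kscale (k t) (mon (gap (fst t) a) (snd t))) = 0" and "t \<in> S"
  shows "k t = 0"
  using assms by (simp add: monomial_basis_def del: scale_scale)

text \<open>Injectivity of monomial multiplication carries the basis in degree \<open>b\<close> to a
  basis of its image in degree \<open>a\<close>, which \<open>C\<close> completes.\<close>

lemma monomial_basis_step:
  assumes inj: "\<And>u v. mon u v = 0 \<Longrightarrow> v = 0"
    and S: "monomial_basis S b" and "b \<le> a"
    and C: "K.complement_basis (G a) (mon (gap b a) ` G b) C"
    and disj: "S \<inter> {a} \<times> C = {}"
  shows "monomial_basis (S \<union> {a} \<times> C) a"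
proof -
  let ?x = "\<lambda>a t. mon (gap (fst t) a) (snd t)"
  have fS: "finite S" and fC: "finite C" and CG: "C \<subseteq> G a"
    and S_hom: "\<And>t. t \<in> S \<Longrightarrow> fst t \<le> b \<and> snd t \<in> G (fst t)"
    using S C by (auto simp: monomial_basis_def K.complement_basis_def)
  have x_b: "?x b t \<in> G b" if "t \<in> S" for t
    using mon_in_G[of "snd t" "fst t" "gap (fst t) b"] S_hom[OF that] shift_gap by metis
  have x_a: "?x a t = mon (gap b a) (?x b t)" if "t \<in> S" for t
    using gap_add[of "fst t" b a] S_hom[OF that] assms(3) by (simp only: mon_mon)
  have sum_S: "(\<Sum>t\<in>S. kscale (k t) (?x b t)) \<in> G b" for k
    by (intro K.subspace_sum K.subspace_scale subspace_G x_b)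
  \<comment> \<open>Old generators factor through degree \<open>b\<close>; a new one
    \<open>(a, c)\<close> contributes \<open>c\<close> itself, its gap being zero.\<close>
  have split: "(\<Sum>t\<in>S \<union> {a} \<times> C. kscale (k t) (?x a t)) =
      mon (gap b a) (\<Sum>t\<in>S. kscale (k t) (?x b t)) + (\<Sum>c\<in>C. kscale (k (a, c)) c)" for k
  proof -
    have "(\<Sum>t\<in>S \<union> {a} \<times> C. kscale (k t) (?x a t)) =
        (\<Sum>t\<in>S. kscale (k t) (?x a t)) + (\<Sum>t\<in>{a} \<times> C. kscale (k t) (?x a t))"
      using fS fC disj by (intro sum.union_disjoint) auto
    moreover have "(\<Sum>t\<in>{a} \<times> C. kscale (k t) (?x a t)) = (\<Sum>c\<in>C. kscale (k (a, c)) c)"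
      by (rule sum.reindex_cong[of "Pair a"]) (auto simp: inj_on_def simp del: scale_scale)
    moreover have "(\<Sum>t\<in>S. kscale (k t) (?x a t)) = mon (gap b a) (\<Sum>t\<in>S. kscale (k t) (?x b t))"
      unfolding mon_sum by (rule sum.cong[OF refl]) (simp only: x_a)
    ultimately show ?thesis by simp
  qed
  have "\<forall>t\<in>S \<union> {a} \<times> C. k t = 0" if z: "(\<Sum>t\<in>S \<union> {a} \<times> C. kscale (k t) (?x a t)) = 0" for k
  proof -
    let ?w = "\<Sum>t\<in>S. kscale (k t) (?x b t)"
    have "mon (gap b a) ?w = 0 \<and> (\<forall>c\<in>C. k (a, c) = 0)"
      using C sum_S[of k] z[unfolded split] unfolding K.complement_basis_def
      by (elim conjE) (erule ballE[of _ _ "mon (gap b a) ?w"], erule allE[of _ "\<lambda>c. k (a, c)"], auto)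
    moreover from this inj have "?w = 0" by blast
    then have "\<forall>t\<in>S. k t = 0" using monomial_basis_indep[OF S, of k] by blast
    ultimately show ?thesis by auto
  qed
  moreover have "\<exists>k. v = (\<Sum>t\<in>S \<union> {a} \<times> C. kscale (k t) (?x a t))" if v: "v \<in> G a" for v
  proof -
    obtain w k where w: "w \<in> G b" and v_eq: "v = mon (gap b a) w + (\<Sum>c\<in>C. kscale (k c) c)"
      using C v unfolding K.complement_basis_def by blast
    obtain k' where k': "w = (\<Sum>t\<in>S. kscale (k' t) (?x b t))"
      using S w unfolding monomial_basis_def by blast
    let ?k = "\<lambda>t. if t \<in> S then k' t else k (snd t)"
    have "(\<Sum>t\<in>S. kscale (?k t) (?x b t)) = w"
      unfolding k' by (rule sum.cong) auto
    moreover have "(\<Sum>c\<in>C. kscale (?k (a, c)) c) = (\<Sum>c\<in>C. kscale (k c) c)"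
      using disj by (intro sum.cong) auto
    ultimately have "v = (\<Sum>t\<in>S \<union> {a} \<times> C. kscale (?k t) (?x a t))"
      by (simp only: split v_eq)
    then show ?thesis by (rule exI[of _ ?k])
  qed
  moreover have "\<forall>t\<in>S \<union> {a} \<times> C. fst t \<le> a \<and> snd t \<in> G (fst t)"
    using S_hom assms(3) CG by (auto intro: order_trans)
  ultimately show ?thesis
    unfolding monomial_basis_def using fS fC by blast
qed

text \<open>A duplicate-free enumeration of \<open>T\<close> gives the list. The work is to reindex
  sums between list positions and generators.\<close>

lemma stanley_decomposition_of_monomial_bases:
  assumes T: "finite T" "\<And>d m. (d, m) \<in> T \<Longrightarrow> m \<in> G d"
    and bases: "\<And>a. monomial_basis {t\<in>T. reaches (Z (fst t)) (fst t) a} a"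
  shows "\<exists>D. stanley_decomposition scale G D \<and> set D = (\<lambda>(d, m). (m, Z d)) ` T"
proof -
  obtain xs where xs: "set xs = T" "distinct xs"
    using finite_distinct_list[OF T(1)] by blast
  let ?D = "map (\<lambda>(d, m). (m, Z d)) xs" and ?d = "\<lambda>i. fst (xs ! i)"
  let ?x = "\<lambda>a t. mon (gap (fst t) a) (snd t)"
  let ?I = "\<lambda>a. {i. i < length xs \<and> reaches (Z (?d i)) (?d i) a}"
    and ?S = "\<lambda>a. {t\<in>T. reaches (Z (fst t)) (fst t) a}"
  have D: "fst (?D ! i) = snd (xs ! i)" "snd (?D ! i) = Z (?d i)" if "i < length xs" for i
    using that by (simp_all add: split_beta)
  have bij: "bij_betw ((!) xs) (?I a) (?S a)" for a
  proof (rule bij_betw_imageI)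
    show "inj_on ((!) xs) (?I a)" using xs(2) by (auto simp: inj_on_def nth_eq_iff_index_eq)
    show "(!) xs ` ?I a = ?S a"
    proof
      show "(!) xs ` ?I a \<subseteq> ?S a" using xs(1) by auto
      show "?S a \<subseteq> (!) xs ` ?I a"
      proof
        fix t assume t: "t \<in> ?S a"
        then obtain i where "i < length xs" "t = xs ! i"
          using xs(1) by (auto simp: in_set_conv_nth)
        then show "t \<in> (!) xs ` ?I a" using t by blast
      qed
    qed
  qed
  have index: "{i. i < length ?D \<and> reaches (snd (?D ! i)) (?d i) a} = ?I a" for a
    using D by auto
  have sum_D: "(\<Sum>i\<in>?I a. kscale (k i) (mon (gap (?d i) a) (fst (?D ! i)))) =
      (\<Sum>i\<in>?I a. kscale (k i) (?x a (xs ! i)))" for k a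
    by (rule sum.cong) (simp_all only: D mem_Collect_eq)
  have "stanley_decomposition scale G ?D"
  proof (rule stanley_decompositionI[where d = ?d])
    show "fst (?D ! i) \<in> G (?d i)" if "i < length ?D" for i
      using that D T(2)[of "?d i" "snd (xs ! i)"] xs(1) by auto
  next
    fix a k i
    assume z: "(\<Sum>i | i < length ?D \<and> reaches (snd (?D ! i)) (?d i) a.
        kscale (k i) (mon (gap (?d i) a) (fst (?D ! i)))) = 0"
      and i: "i < length ?D" "reaches (snd (?D ! i)) (?d i) a"
    let ?k = "\<lambda>t. k (the_inv_into (?I a) ((!) xs) t)"
    have inv: "?k (xs ! j) = k j" if "j \<in> ?I a" for j
      using the_inv_into_f_f[OF bij_betw_imp_inj_on[OF bij] that] by simp
    have "(\<Sum>t\<in>?S a. kscale (?k t) (?x a t)) = (\<Sum>j\<in>?I a. kscale (?k (xs ! j)) (?x a (xs ! j)))"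
      by (rule sum.reindex_bij_betw[OF bij, symmetric])
    also have "\<dots> = (\<Sum>j\<in>?I a. kscale (k j) (?x a (xs ! j)))"
      by (rule sum.cong[OF refl]) (simp only: inv)
    also have "\<dots> = 0" using z by (simp only: index sum_D)
    finally have "?k t = 0" if "t \<in> ?S a" for t
      using monomial_basis_indep[OF bases, of ?k a t] that by blast
    moreover have I: "i \<in> ?I a" using i D by auto
    then have "xs ! i \<in> ?S a" using bij_betwE[OF bij] by blast
    ultimately show "k i = 0" using inv[OF I] by simp
  next
    fix a v assume "v \<in> G a"
    then obtain k where k: "v = (\<Sum>t\<in>?S a. kscale (k t) (?x a t))"
      using bases[of a] unfolding monomial_basis_def by blast
    have "v = (\<Sum>i\<in>?I a. kscale (k (xs ! i)) (?x a (xs ! i)))"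
      unfolding k by (rule sum.reindex_bij_betw[OF bij, symmetric])
    then show "\<exists>k. v = (\<Sum>i | i < length ?D \<and> reaches (snd (?D ! i)) (?d i) a.
        kscale (k i) (mon (gap (?d i) a) (fst (?D ! i))))"
      unfolding index sum_D by (rule exI[of _ "\<lambda>i. k (xs ! i)"])
  qed
  then show ?thesis using xs(1) by (intro exI[of _ ?D]) simp
qed

lemma ex_stanley_decomposition:
  assumes "finitely_generated scale" "torsion_free scale"
  shows "\<exists>D. stanley_decomposition scale G D \<and> (\<forall>(m, Z)\<in>set D. Z \<noteq> {})"
proof -
  obtain l h where fin: "\<And>a. \<exists>F. finite F \<and> G a \<subseteq> K.span F"
    and low: "\<And>a v. v \<in> G a \<Longrightarrow> v \<noteq> 0 \<Longrightarrow> l \<le> a"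
    and surj: "\<And>b a. b \<le> a \<Longrightarrow> (\<And>i. b i < a i \<Longrightarrow> h i \<le> b i) \<Longrightarrow> G a \<subseteq> mon (gap b a) ` G b"
    using finitely_generated_bounds[OF assms(1)] by metis
  \<comment> \<open>Torsion freeness enters here, through the nonzero polynomials
    \<open>single u 1\<close>.\<close>
  have inj: "v = 0" if "mon u v = 0" for u v
    using assms(2) that unfolding torsion_free_def by (metis lookup_single_eq lookup_zero zero_neq_one)
  fix p :: 'n
  let ?b = "parent p l h" and ?Z = "dirs p h"
  \<comment> \<open>The part of degree \<open>a\<close> inherited from the parent; the complement
    \<open>C a\<close> below consists of the new generators.\<close>
  define W where "W a = mon (gap (?b a) a) ` G (?b a)" for a
  have subW: "K.subspace (W a)" for a
  proof -
    have "module_hom kscale kscale (mon (gap (?b a) a))"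
      by unfold_locales (auto simp: scale_right_distrib mult.commute)
    then show ?thesis unfolding W_def by (rule module_hom.subspace_image[OF _ subspace_G])
  qed
  have WG: "W a \<subseteq> G a" for a
    unfolding W_def
  proof (rule image_subsetI)
    fix v assume "v \<in> G (?b a)"
    then show "mon (gap (?b a) a) v \<in> G a"
      using mon_in_G[of v "?b a" "gap (?b a) a"] by (simp only: shift_gap[OF parent_le])
  qed
  have "\<exists>C. K.complement_basis (G a) (W a) C" for a
    using fin[of a] K.ex_complement_basis[OF _ _ subspace_G subW WG] by blast
  then obtain C where C: "\<And>a. K.complement_basis (G a) (W a) (C a)" by metis
  have C_G: "C a \<subseteq> G a" and fC: "finite (C a)" for a
    using C[of a] by (auto simp: K.complement_basis_def)
  have C_W: "m \<notin> W a" if m: "m \<in> C a" for a m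
  proof
    assume "m \<in> W a"
    then have w: "- m \<in> W a" by (rule K.subspace_neg[OF subW])
    let ?k = "\<lambda>c. if c = m then 1 else 0 :: 'k"
    have "(\<Sum>c\<in>C a. kscale (?k c) c) = (\<Sum>c\<in>C a. if c = m then m else 0)"
      by (rule sum.cong) auto
    then have "- m + (\<Sum>c\<in>C a. kscale (?k c) c) = 0" using m fC[of a] by simp
    moreover have indep: "\<forall>c\<in>C a. k c = 0" if "- m + (\<Sum>c\<in>C a. kscale (k c) c) = 0" for k
      using C[of a] w that unfolding K.complement_basis_def by blast
    ultimately have "\<forall>c\<in>C a. ?k c = 0" by (intro indep[of ?k])
    then show False using m by auto
  qed
  \<comment> \<open>New generators are nonzero, which forces \<open>l \<le> d\<close>; outside
    \<open>d \<le> h\<close> the inherited part is the whole component. Hence \<open>T\<close> can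
    be cut to a finite box without loss.\<close>
  have box: "l \<le> d" "d \<le> h" if m: "m \<in> C d" for d m
  proof -
    have "m \<noteq> 0" using C_W[OF m] K.subspace_0[OF subW[of d]] by metis
    then show "l \<le> d" using low[of m d] m C_G[of d] by blast
    show "d \<le> h"
    proof (rule ccontr)
      assume "\<not> d \<le> h"
      then have "G d \<subseteq> W d"
        unfolding W_def by (rule surj[OF parent_le parent_less_imp_ge])
      then show False using C_W[OF m] C_G[of d] m by blast
    qed
  qed
  define T where "T = Sigma {l..h} C"
  have T: "(d, m) \<in> T \<longleftrightarrow> m \<in> C d" for d m
    using box by (auto simp: T_def)
  let ?S = "\<lambda>a. {t\<in>T. reaches (?Z (fst t)) (fst t) a}"
  have "monomial_basis (?S a) a" for a
  \<comment> \<open>The measure is the truncated distance from \<open>l\<close>. It may fail to drop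
    when the parent is not above \<open>l\<close>, but there the component vanishes and
    \<open>zero\<close> gives the empty basis directly.\<close>
  proof (induction "\<Sum>i\<in>UNIV. nat (a i - l i)" arbitrary: a rule: less_induct)
    case (less a)
    have zero: "monomial_basis (?S a) a" if a: "\<not> l \<le> a" for a
    proof -
      have "?S a = {}"
      proof (intro equals0I)
        fix t assume t: "t \<in> ?S a"
        then have "l \<le> fst t" by (auto simp: T_def)
        moreover have "fst t \<le> a" using t by (simp add: reaches_def)
        ultimately show False using a by (metis order_trans)
      qed
      moreover have "v = 0" if "v \<in> G a" for v using low[OF that] a by blast
      then have "monomial_basis {} a" by (auto simp: monomial_basis_def)
      ultimately show ?thesis by (simp only:)
    qed
    show ?case
    proof (cases "l \<le> a")
      case True
      have parent: "monomial_basis (?S (?b a)) (?b a)"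
      proof (cases "l \<le> ?b a")
        case lb: True
        have "(\<Sum>i\<in>UNIV. nat (?b a i - l i)) < (\<Sum>i\<in>UNIV. nat (a i - l i))"
        proof (rule sum_strict_mono_ex1)
          show "\<forall>i\<in>UNIV. nat (?b a i - l i) \<le> nat (a i - l i)"
            using le_funD[OF parent_le[of p l h a]] by (auto intro!: nat_mono)
          obtain i where "?b a i \<noteq> a i" using parent_neq[OF True] by (metis ext)
          then have "?b a i < a i" using le_funD[OF parent_le[of p l h a], of i] by simp
          then show "\<exists>i\<in>UNIV. nat (?b a i - l i) < nat (a i - l i)"
            using le_funD[OF lb, of i] by (intro bexI[of _ i]) auto
        qed simp
        then show ?thesis by (rule less)
      qed (rule zero)
      have S_a: "?S a = ?S (?b a) \<union> {a} \<times> C a"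
      proof (rule set_eqI)
        fix t :: "('n \<Rightarrow> int) \<times> 'm"
        obtain d m where t: "t = (d, m)" by (cases t)
        show "t \<in> ?S a \<longleftrightarrow> t \<in> ?S (?b a) \<union> {a} \<times> C a"
          using reaches_parent[of l d h p a] box[of m d] T[of d m] by (auto simp: t)
      qed
      \<comment> \<open>A generator of degree \<open>a\<close> cannot reach the parent, so the new
        generators are not counted twice.\<close>
      have "\<not> a \<le> ?b a"
        using parent_neq[OF True, of p h] parent_le[of p l h a] by (metis antisym)
      then have disj: "?S (?b a) \<inter> {a} \<times> C a = {}" by (auto simp: reaches_def)
      show ?thesis
        unfolding S_a by (rule monomial_basis_step[OF inj parent parent_le C[unfolded W_def] disj])
    qed (rule zero)
  qed
  moreover have "finite T"
    unfolding T_def using finite_atLeastAtMost_fun fC by (rule finite_SigmaI)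
  moreover have "m \<in> G d" if "(d, m) \<in> T" for d m using that C_G[of d] by (auto simp: T)
  ultimately have "\<exists>D. stanley_decomposition scale G D \<and> set D = (\<lambda>(d, m). (m, ?Z d)) ` T"
    by (intro stanley_decomposition_of_monomial_bases)
  then obtain D where "stanley_decomposition scale G D" "set D = (\<lambda>(d, m). (m, ?Z d)) ` T"
    by blast
  then show ?thesis by (intro exI[of _ D]) (auto simp: dirs_nonempty)
qed

end

section \<open>From the decomposition to the Stanley depth\<close>

theorem corollary1p5:
  fixes scale :: "('n::finite, 'k::field) polynomial \<Rightarrow> 'm::ab_group_add \<Rightarrow> 'm"
    and G :: "('n \<Rightarrow> int) \<Rightarrow> 'm set"
  assumes "graded_module scale G"
    and "finitely_generated scale"
    and "\<exists>v::'m. v \<noteq> 0"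
    and "torsion_free scale"
  shows "sdepth scale G \<ge> 1"
proof -
  interpret graded_polynomial_module scale G
    using assms(1) by unfold_locales
  obtain D where D: "stanley_decomposition scale G D" "\<forall>(m, Z)\<in>set D. Z \<noteq> {}"
    using ex_stanley_decomposition[OF assms(2,4)] by blast
  \<comment> \<open>An empty direct sum is zero, so \<open>Min\<close> is never taken over an empty
    set.\<close>
  have nonempty: "D' \<noteq> []" if "stanley_decomposition scale G D'" for D'
  proof
    assume "D' = []"
    then have "v = 0" for v :: 'm
      using that by (auto simp: stanley_decomposition_def is_direct_sum_def)
    then show False using assms(3) by blast
  qed
  let ?X = "{sdepth_decomp D | D. stanley_decomposition scale G D}"
  \<comment> \<open>The number of variables bounds all values, so the set under \<open>Max\<close>
    is finite.\<close>
  have "sdepth_decomp D' \<le> card (UNIV :: 'n set)" if D': "stanley_decomposition scale G D'" for D'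
  proof -
    have "sdepth_decomp D' \<in> (\<lambda>(m, Z). card Z) ` set D'"
      unfolding sdepth_decomp_def using nonempty[OF D'] by (intro Min_in) auto
    then show ?thesis by (auto intro!: card_mono[OF finite subset_UNIV])
  qed
  then have "finite ?X" by (intro finite_subset[of ?X "{..card (UNIV :: 'n set)}"]) auto
  then have "sdepth_decomp D \<le> sdepth scale G"
    unfolding sdepth_def using D(1) by (intro Max_ge) auto
  moreover have "1 \<le> sdepth_decomp D"
    unfolding sdepth_decomp_def using nonempty[OF D(1)] D(2)
    by (subst Min_ge_iff) (auto simp: Suc_le_eq card_gt_0_iff)
  ultimately show ?thesis by simp
qed

end
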